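(* There exists a monotonically growing temporal grid $\mathcal{G}$ (that is, a monotonically growing temporal graph whose underlying static graph is a grid graph) such that there is no Nash equilibrium in the two-player reverse temporal Voronoi game $\mathrm{rVor}(\mathcal{G},2)$.
   Context: A temporal graph $\mathcal{G}=(V,(E_t)_{t=1}^\infty)$ consists of a finite nonempty vertex set $V$ and an infinite sequence of edge sets $E_t\subseteq\binom{V}{2}$; it is assumed that the sequence is eventually constant (finite lifetime), i.e. there is $\tau$ with $E_t=E_\tau$ for all $t\ge\tau$. The underlying static graph is $(V,\bigcup_{t\ge1}E_t)$. With $[n]=\{1,\dots,n\}$, an $(n\times m)$-grid graph is a static graph isomorphic to $([n]\times[m],\{\{(i,j),(i',j')\}\mid |i-i'|+|j-j'|=1\})$. A temporal grid is a temporal graph whose underlying graph is an $(n\times m)$-grid graph for some $n,m$. $\mathcal{G}$ is monotonically growing if $E_t\subseteq E_{t+1}$ for all $t\ge 1$. A temporal walk from $u$ to $v$ is a sequence $(\{v_0=u,v_1\},t_1),(\{v_1,v_2\},t_2),\dots,(\{v_{d-1},v_d=v\},t_d)$ with $t_i<t_{i+1}$ for all $i\in\{1,\dots,d-1\}$ (strictly increasing times) and $\{v_{i-1},v_i\}\in E_{t_i}$ for all $i\in\{1,\dots,d\}$; its arrival time is $t_d$. The temporal distance $\mathrm{td}(u,v)$ is the minimum arrival time of a temporal walk from $u$ to $v$, with $\mathrm{td}(u,u)=0$ and $\mathrm{td}(u,v)=\infty$ if there is no such walk. In the two-player reverse temporal Voronoi game $\mathrm{rVor}(\mathcal{G},2)$,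 each player $i\in\{1,2\}$ selects one vertex $p_i\in V$ (equal choices are allowed). Player $i$ wins the set $U_i(p_1,p_2)=\{v\in V\mid \mathrm{td}(v,p_i)<\mathrm{td}(v,p_j)\}$, where $j\ne i$ is the other player, and her payoff is $u_i(p_1,p_2)=|U_i(p_1,p_2)|$. A profile $(p_1,p_2)\in V^2$ is a Nash equilibrium if $u_1(p',p_2)\le u_1(p_1,p_2)$ and $u_2(p_1,p')\le u_2(p_1,p_2)$ for all $p'\in V$. *)

theory Defs
  imports Main "HOL-Library.Extended_Nat"
begin

text \<open>A temporal graph is given by its vertex set \<open>V\<close> and its edge sets \<open>E t\<close>. Time steps start
  at 1, so the value \<open>E 0\<close> is junk and is never inspected.\<close>

definition temporal_graph :: "'a set \<Rightarrow> (nat \<Rightarrow> 'a set set) \<Rightarrow> bool" where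
  "temporal_graph V E \<longleftrightarrow>
     finite V \<and> V \<noteq> {} \<and>
     (\<forall>t\<ge>1. E t \<subseteq> {e. e \<subseteq> V \<and> card e = 2}) \<and>
     (\<exists>\<tau>\<ge>1. \<forall>t\<ge>\<tau>. E t = E \<tau>)"

definition underlying_edges :: "(nat \<Rightarrow> 'a set set) \<Rightarrow> 'a set set" where
  "underlying_edges E = (\<Union>t\<in>{1..}. E t)"

definition monotonically_growing :: "(nat \<Rightarrow> 'a set set) \<Rightarrow> bool" where
  "monotonically_growing E \<longleftrightarrow> (\<forall>t\<ge>1. E t \<subseteq> E (Suc t))"

definition static_graph :: "'a set \<Rightarrow> 'a set set \<Rightarrow> bool" where
  "static_graph V F \<longleftrightarrow> F \<subseteq> {e. e \<subseteq> V \<and> card e = 2}"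

definition graph_isomorphic :: "'a set \<Rightarrow> 'a set set \<Rightarrow> 'b set \<Rightarrow> 'b set set \<Rightarrow> bool" where
  "graph_isomorphic V F V' F' \<longleftrightarrow>
     (\<exists>f. bij_betw f V V' \<and> (\<forall>u\<in>V. \<forall>v\<in>V. {u, v} \<in> F \<longleftrightarrow> {f u, f v} \<in> F'))"

text \<open>Coordinates are integers so that the differences do not truncate.\<close>

definition grid_vertices :: "nat \<Rightarrow> nat \<Rightarrow> (int \<times> int) set" where
  "grid_vertices n m = {1..int n} \<times> {1..int m}"

definition grid_edges :: "nat \<Rightarrow> nat \<Rightarrow> (int \<times> int) set set" where
  "grid_edges n m =
     {{(i, j), (i', j')} | i j i' j'.
        (i, j) \<in> grid_vertices n m \<and> (i', j') \<in> grid_vertices n m \<and>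
        \<bar>i - i'\<bar> + \<bar>j - j'\<bar> = 1}"

definition grid_graph :: "nat \<Rightarrow> nat \<Rightarrow> 'a set \<Rightarrow> 'a set set \<Rightarrow> bool" where
  "grid_graph n m V F \<longleftrightarrow>
     static_graph V F \<and> graph_isomorphic V F (grid_vertices n m) (grid_edges n m)"

definition temporal_grid :: "'a set \<Rightarrow> (nat \<Rightarrow> 'a set set) \<Rightarrow> bool" where
  "temporal_grid V E \<longleftrightarrow>
     temporal_graph V E \<and> (\<exists>n\<ge>1. \<exists>m\<ge>1. grid_graph n m V (underlying_edges E))"

text \<open>A temporal walk is a nonempty list of time edges (edge, time); \<open>vs\<close> lists the visited
  vertices \<open>v\<^sub>0, \<dots>, v\<^sub>d\<close>.\<close>

definition temporal_walk ::
  "(nat \<Rightarrow> 'a set set) \<Rightarrow> 'a \<Rightarrow> 'a \<Rightarrow> ('a set \<times> nat) list \<Rightarrow> bool" where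
  "temporal_walk E u v w \<longleftrightarrow>
     w \<noteq> [] \<and>
     (\<exists>vs. length vs = Suc (length w) \<and> vs ! 0 = u \<and> vs ! length w = v \<and>
        (\<forall>i<length w. fst (w ! i) = {vs ! i, vs ! Suc i})) \<and>
     (\<forall>i<length w. 1 \<le> snd (w ! i) \<and> fst (w ! i) \<in> E (snd (w ! i))) \<and>
     (\<forall>i. Suc i < length w \<longrightarrow> snd (w ! i) < snd (w ! Suc i))"

definition arrival_time :: "('a set \<times> nat) list \<Rightarrow> nat" where
  "arrival_time w = snd (last w)"

text \<open>The infimum in \<^typ>\<open>enat\<close> is a minimum if some walk exists, and \<open>\<infinity>\<close> otherwise.\<close>

definition temporal_distance :: "(nat \<Rightarrow> 'a set set) \<Rightarrow> 'a \<Rightarrow> 'a \<Rightarrow> enat" where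
  "temporal_distance E u v =
     (if u = v then 0 else (INF w\<in>{w. temporal_walk E u v w}. enat (arrival_time w)))"

text \<open>In \<open>rvor_won V E p q\<close> and \<open>rvor_payoff V E p q\<close>, the vertex \<open>p\<close> is the player's own
  choice and \<open>q\<close> the choice of the opponent. Distances are measured towards the chosen
  vertices.\<close>

definition rvor_won :: "'a set \<Rightarrow> (nat \<Rightarrow> 'a set set) \<Rightarrow> 'a \<Rightarrow> 'a \<Rightarrow> 'a set" where
  "rvor_won V E p q = {v \<in> V. temporal_distance E v p < temporal_distance E v q}"

definition rvor_payoff :: "'a set \<Rightarrow> (nat \<Rightarrow> 'a set set) \<Rightarrow> 'a \<Rightarrow> 'a \<Rightarrow> nat" where
  "rvor_payoff V E p q = card (rvor_won V E p q)"

definition rvor_nash_equilibrium ::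
  "'a set \<Rightarrow> (nat \<Rightarrow> 'a set set) \<Rightarrow> 'a \<Rightarrow> 'a \<Rightarrow> bool" where
  "rvor_nash_equilibrium V E p1 p2 \<longleftrightarrow>
     p1 \<in> V \<and> p2 \<in> V \<and>
     (\<forall>p'\<in>V. rvor_payoff V E p' p2 \<le> rvor_payoff V E p1 p2) \<and>
     (\<forall>p'\<in>V. rvor_payoff V E p' p1 \<le> rvor_payoff V E p2 p1)"

end

theory Submission imports Defs begin

text \<open>
  The witness is the following \<open>2 \<times> 3\<close> grid, in which each edge is labelled with the time from
  which it is present; it was found by computer search.

  \<^verbatim>\<open>
    (0,0) --3-- (0,1) --2-- (0,2)
      |           |           |
      2           4           1
      |           |           |
    (1,0) --4-- (1,1) --3-- (1,2)
  \<close>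

  Temporal distances from \<open>u\<close> are recognised by a Bellman-type criterion: a function \<open>d\<close> with
  \<open>d u = 0\<close> is the distance if no edge at time \<open>t\<close> leads from a vertex with \<open>d < t\<close> to one with
  \<open>d > t\<close>, and if every \<open>v \<noteq> u\<close> has an edge at time \<open>d v\<close> to a vertex with a smaller value.
  A table of distances is therefore certified by finitely many comparisons, and the absence of
  equilibria is a finite check of the resulting payoffs.
\<close>

lemma temporal_walk_single:
  assumes "1 \<le> t" "{u, v} \<in> E t"
  shows "temporal_walk E u v [({u, v}, t)]"
  unfolding temporal_walk_def using assms by (auto intro!: exI[of _ "[u, v]"])

lemma temporal_walk_snoc:
  assumes w: "temporal_walk E u x w" and t: "arrival_time w < t" and e: "{x, v} \<in> E t"
  shows "temporal_walk E u v (w @ [({x, v}, t)])"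
proof -
  let ?n = "length w" and ?w = "w @ [({x, v}, t)]"
  obtain vs where vs: "length vs = Suc ?n" "vs ! 0 = u" "vs ! ?n = x"
    "\<And>i. i < ?n \<Longrightarrow> fst (w ! i) = {vs ! i, vs ! Suc i}"
    using w by (auto simp: temporal_walk_def)
  \<comment> \<open>Besides ordering the last two edges, this gives \<open>1 \<le> t\<close>, the
    validity of the appended time.\<close>
  have last: "snd (w ! (?n - 1)) < t" "w \<noteq> []"
    using w t by (auto simp: temporal_walk_def arrival_time_def last_conv_nth)
  have "\<forall>i<length ?w. fst (?w ! i) = {(vs @ [v]) ! i, (vs @ [v]) ! Suc i}"
    using vs by (auto simp: nth_append less_Suc_eq)
  moreover have "(vs @ [v]) ! 0 = u" "(vs @ [v]) ! length ?w = v"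
    using vs by (auto simp: nth_append)
  moreover have "\<forall>i<length ?w. 1 \<le> snd (?w ! i) \<and> fst (?w ! i) \<in> E (snd (?w ! i))"
    using w e last by (auto simp: temporal_walk_def nth_append less_Suc_eq)
  moreover have "snd (?w ! i) < snd (?w ! Suc i)" if "Suc i < length ?w" for i
  proof (cases "Suc i = ?n")
    case True
    then have "i = ?n - 1" "i < ?n" by auto
    then show ?thesis using last True by (simp add: nth_append)
  next
    case False
    then show ?thesis using that w by (auto simp: temporal_walk_def nth_append)
  qed
  ultimately show ?thesis
    unfolding temporal_walk_def using vs(1) by (intro conjI exI[of _ "vs @ [v]"]) auto
qed

text \<open>By induction along the walk, each edge ends at a vertex whose \<open>d\<close> is at
  most the time of that edge. As times strictly increase, \<open>d\<close> is below the time of the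
  next edge, so \<open>step\<close> applies again; the first edge is covered by
  \<open>d u = 0\<close> and times being at least 1.\<close>

lemma arrival_time_lower_bound:
  fixes d :: "'a \<Rightarrow> nat"
  assumes "d u = 0"
    and step: "\<And>t x y. 1 \<le> t \<Longrightarrow> {x, y} \<in> E t \<Longrightarrow> d x < t \<Longrightarrow> d y \<le> t"
    and w: "temporal_walk E u v w"
  shows "d v \<le> arrival_time w"
proof -
  obtain vs where vs: "length vs = Suc (length w)" "vs ! 0 = u" "vs ! length w = v"
    "\<And>i. i < length w \<Longrightarrow> fst (w ! i) = {vs ! i, vs ! Suc i}"
    using w by (auto simp: temporal_walk_def)
  have E: "1 \<le> snd (w ! i)" "{vs ! i, vs ! Suc i} \<in> E (snd (w ! i))" if "i < length w" for i
    using w that vs(4)[OF that] by (auto simp: temporal_walk_def)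
  have bound: "d (vs ! Suc i) \<le> snd (w ! i)" if "i < length w" for i
    using that
  proof (induction i)
    case 0
    then show ?case using step[OF E[OF 0]] E(1)[OF 0] vs(2) assms(1) by simp
  next
    case (Suc i)
    then have "d (vs ! Suc i) < snd (w ! Suc i)"
      using w by (fastforce simp: temporal_walk_def)
    then show ?case using step[OF E[OF Suc.prems]] by simp
  qed
  have "w \<noteq> []" using w by (simp add: temporal_walk_def)
  then show ?thesis
    using bound[of "length w - 1"] vs(3) by (simp add: arrival_time_def last_conv_nth)
qed

lemma temporal_distance_eqI:
  fixes d :: "'a \<Rightarrow> nat"
  assumes d_source: "d u = 0"
    and step: "\<And>t x y. 1 \<le> t \<Longrightarrow> {x, y} \<in> E t \<Longrightarrow> d x < t \<Longrightarrow> d y \<le> t"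
    and pred: "\<And>v. v \<in> V \<Longrightarrow> v \<noteq> u \<Longrightarrow> \<exists>x\<in>V. {x, v} \<in> E (d v) \<and> d x < d v"
    and "v \<in> V"
  shows "temporal_distance E u v = enat (d v)"
proof (cases "v = u")
  case True
  then show ?thesis by (simp add: temporal_distance_def d_source zero_enat_def)
next
  case False
  \<comment> \<open>Following predecessors down to \<open>u\<close> yields a walk that meets the
    lower bound, so the infimum is attained.\<close>
  have walk: "\<exists>w. temporal_walk E u v w \<and> arrival_time w = d v" if "v \<in> V" "v \<noteq> u" for v
    using that
  proof (induction "d v" arbitrary: v rule: less_induct)
    case less
    obtain x where x: "x \<in> V" "{x, v} \<in> E (d v)" "d x < d v"
      using pred[OF less.prems] by blast
    show ?case
    proof (cases "x = u")
      case True
      then show ?thesis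
        using temporal_walk_single[of "d v" u v E] x
        by (intro exI[of _ "[({u, v}, d v)]"]) (auto simp: arrival_time_def)
    next
      case False
      then obtain w where "temporal_walk E u x w" "arrival_time w = d x"
        using less.hyps x by blast
      then show ?thesis
        using temporal_walk_snoc[of E u x w "d v" v] x
        by (intro exI[of _ "w @ [({x, v}, d v)]"]) (auto simp: arrival_time_def)
    qed
  qed
  have "(INF w\<in>{w. temporal_walk E u v w}. enat (arrival_time w)) = enat (d v)"
  proof (rule antisym)
    show "(INF w\<in>{w. temporal_walk E u v w}. enat (arrival_time w)) \<le> enat (d v)"
      using walk[OF \<open>v \<in> V\<close> False] by (metis INF_lower mem_Collect_eq)
    show "enat (d v) \<le> (INF w\<in>{w. temporal_walk E u v w}. enat (arrival_time w))"
      using arrival_time_lower_bound[of d u E v, OF d_source step] by (intro INF_greatest) auto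
  qed
  then show ?thesis using False by (simp add: temporal_distance_def)
qed

lemma doubleton_mem_grid_edges:
  "{(i, j), (i', j')} \<in> grid_edges n m \<longleftrightarrow>
     (i, j) \<in> grid_vertices n m \<and> (i', j') \<in> grid_vertices n m \<and> \<bar>i - i'\<bar> + \<bar>j - j'\<bar> = 1"
  unfolding grid_edges_def by (auto simp: doubleton_eq_iff)

definition labelled_edges :: "((nat \<times> nat) \<times> (nat \<times> nat) \<times> nat) list" where
  "labelled_edges =
     [((0, 0), (0, 1), 3), ((0, 1), (0, 2), 2),
      ((0, 0), (1, 0), 2), ((0, 1), (1, 1), 4), ((0, 2), (1, 2), 1),
      ((1, 0), (1, 1), 4), ((1, 1), (1, 2), 3)]"

definition V23 :: "(nat \<times> nat) set" where
  "V23 = {0, 1} \<times> {0, 1, 2}"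

definition E23 :: "nat \<Rightarrow> (nat \<times> nat) set set" where
  "E23 t = {{x, y} | x y s. (x, y, s) \<in> set labelled_edges \<and> s \<le> t}"

text \<open>Edges are listed in one orientation only, so both have to be tried; membership becomes a
  search in a finite list.\<close>

lemma doubleton_mem_E23:
  "{x, y} \<in> E23 t \<longleftrightarrow>
     (\<exists>(a, b, s)\<in>set labelled_edges. s \<le> t \<and> (a = x \<and> b = y \<or> a = y \<and> b = x))"
  unfolding E23_def by (auto simp: doubleton_eq_iff) blast+

text \<open>Row \<open>u\<close>, column \<open>v\<close> holds the distance from \<open>u\<close>
  to \<open>v\<close>, with vertices in lexicographic order. The table is not symmetric, since
  reversing a walk does not keep its times increasing.\<close>

definition dist_table :: "nat list list" where
  "dist_table =
     [[0, 3, 4, 2, 4, 5],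
      [3, 0, 2, 4, 4, 3],
      [3, 2, 0, 4, 3, 1],
      [2, 3, 4, 0, 4, 5],
      [5, 4, 4, 4, 0, 3],
      [3, 2, 1, 4, 3, 0]]"

definition dist23 :: "nat \<times> nat \<Rightarrow> nat \<times> nat \<Rightarrow> nat" where
  "dist23 u v = dist_table ! (3 * fst u + snd u) ! (3 * fst v + snd v)"

lemma labelled_edgeD:
  assumes "(x, y, s) \<in> set labelled_edges"
  shows "x \<in> V23" "y \<in> V23" "x \<noteq> y" "s \<le> 4"
  using assms by (auto simp: labelled_edges_def V23_def)

lemma E23_subset: "E23 t \<subseteq> {e. e \<subseteq> V23 \<and> card e = 2}"
  by (auto simp: E23_def card_2_iff dest: labelled_edgeD)

lemma E23_mono: "s \<le> t \<Longrightarrow> E23 s \<subseteq> E23 t"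
  unfolding E23_def by (blast intro: le_trans)

lemma E23_subset_4: "E23 t \<subseteq> E23 4"
  unfolding E23_def by (blast dest: labelled_edgeD(4))

lemma underlying_edges_E23: "underlying_edges E23 = E23 4"
proof
  show "underlying_edges E23 \<subseteq> E23 4"
    using E23_subset_4 by (auto simp: underlying_edges_def)
  show "E23 4 \<subseteq> underlying_edges E23"
    unfolding underlying_edges_def by (rule UN_upper) simp
qed

lemma monotonically_growing_E23: "monotonically_growing E23"
  by (simp add: monotonically_growing_def E23_mono)

lemma temporal_grid_23: "temporal_grid V23 E23"
proof -
  \<comment> \<open>Shifts 0-based natural coordinates to the 1-based integer ones of the
    grid.\<close>
  let ?f = "\<lambda>(i, j). (int i + 1, int j + 1)"
  have const: "E23 t = E23 4" if "4 \<le> t" for t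
    using E23_mono[OF that] E23_subset_4 by (rule antisym[rotated])
  have tg: "temporal_graph V23 E23"
    unfolding temporal_graph_def
  proof (intro conjI)
    show "\<exists>\<tau>\<ge>1. \<forall>t\<ge>\<tau>. E23 t = E23 \<tau>"
      by (intro exI[of _ 4] conjI allI impI const) simp
  qed (use E23_subset in \<open>auto simp: V23_def\<close>)
  have "bij_betw ?f V23 (grid_vertices 2 3)"
  proof -
    have "{1..int 2} = {1, 2}" "{1..int 3} = {1, 2, 3}" by auto
    then show ?thesis by (auto simp: bij_betw_def inj_on_def V23_def grid_vertices_def)
  qed
  moreover have "\<forall>u\<in>V23. \<forall>v\<in>V23. {u, v} \<in> E23 4 \<longleftrightarrow> {?f u, ?f v} \<in> grid_edges 2 3"
    \<comment> \<open>For \<open>u = v\<close>, collapsing \<open>{u, u}\<close> to a singleton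
      would keep the doubleton rules from matching.\<close>
    by (simp add: doubleton_mem_E23 doubleton_mem_grid_edges grid_vertices_def V23_def
        labelled_edges_def del: insert_absorb2)
  ultimately have "graph_isomorphic V23 (E23 4) (grid_vertices 2 3) (grid_edges 2 3)"
    unfolding graph_isomorphic_def by blast
  then have "grid_graph 2 3 V23 (underlying_edges E23)"
    using E23_subset by (simp add: grid_graph_def static_graph_def underlying_edges_E23)
  moreover have "(1::nat) \<le> 2" "(1::nat) \<le> 3" by auto
  ultimately show ?thesis
    unfolding temporal_grid_def using tg by blast
qed

text \<open>An edge labelled \<open>s\<close> is present at all times from \<open>s\<close> on, so
  after reaching \<open>x\<close> it can first be used at time
  \<open>max (dist23 u x + 1) s\<close>. Checking this one time in each direction settles the step
  condition for all \<open>t\<close>.\<close>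

lemma dist23_step:
  "\<forall>u\<in>V23. \<forall>(x, y, s)\<in>set labelled_edges.
     dist23 u y \<le> max (dist23 u x + 1) s \<and> dist23 u x \<le> max (dist23 u y + 1) s"
  by (simp add: V23_def labelled_edges_def dist23_def dist_table_def)

lemma dist23_pred:
  "\<forall>u\<in>V23. \<forall>v\<in>V23. v \<noteq> u \<longrightarrow> (\<exists>x\<in>V23. {x, v} \<in> E23 (dist23 u v) \<and> dist23 u x < dist23 u v)"
  unfolding doubleton_mem_E23
  by (simp add: V23_def labelled_edges_def dist23_def dist_table_def)

lemma temporal_distance_E23:
  assumes "u \<in> V23" "v \<in> V23"
  shows "temporal_distance E23 u v = enat (dist23 u v)"
proof (rule temporal_distance_eqI)
  show "dist23 u u = 0"
    using assms(1) by (auto simp: V23_def dist23_def dist_table_def)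
  show "dist23 u y \<le> t" if "{x, y} \<in> E23 t" "dist23 u x < t" for t x y
    using that dist23_step assms(1) by (fastforce simp: doubleton_mem_E23)
  show "\<exists>x\<in>V23. {x, w} \<in> E23 (dist23 u w) \<and> dist23 u x < dist23 u w"
    if "w \<in> V23" "w \<noteq> u" for w
    using dist23_pred assms(1) that by blast
qed (rule assms)

text \<open>As a sum of indicators, the payoff can be evaluated by rewriting once
  \<open>sum_V23\<close> lists the terms.\<close>

lemma rvor_payoff_23:
  assumes "p \<in> V23" "q \<in> V23"
  shows "rvor_payoff V23 E23 p q = (\<Sum>v\<in>V23. of_bool (dist23 v p < dist23 v q))"
proof -
  have "rvor_won V23 E23 p q = V23 \<inter> {v. dist23 v p < dist23 v q}"
    using assms by (auto simp: rvor_won_def temporal_distance_E23)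
  moreover have "finite V23" by (simp add: V23_def)
  ultimately show ?thesis by (simp add: rvor_payoff_def)
qed

lemma sum_V23:
  "(\<Sum>v\<in>V23. f v) = f (0, 0) + f (0, 1) + f (0, 2) + f (1, 0) + f (1, 1) + f (1, 2)"
  by (simp add: V23_def ac_simps flip: sum.cartesian_product)

lemma profitable_deviation:
  assumes "p \<in> V23" "q \<in> V23"
  shows "\<exists>p'\<in>V23. rvor_payoff V23 E23 p q < rvor_payoff V23 E23 p' q \<or>
    rvor_payoff V23 E23 q p < rvor_payoff V23 E23 p' p"
proof -
  \<comment> \<open>All 36 profiles are evaluated from the table; the disjunction leaves open which
    of the two players gains by moving to \<open>p'\<close>.\<close>
  have "\<forall>p\<in>V23. \<forall>q\<in>V23. \<exists>p'\<in>V23.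
      (\<Sum>v\<in>V23. of_bool (dist23 v p < dist23 v q) :: nat)
        < (\<Sum>v\<in>V23. of_bool (dist23 v p' < dist23 v q)) \<or>
      (\<Sum>v\<in>V23. of_bool (dist23 v q < dist23 v p) :: nat)
        < (\<Sum>v\<in>V23. of_bool (dist23 v p' < dist23 v p))"
    unfolding sum_V23 by (simp add: V23_def dist23_def dist_table_def)
  then show ?thesis using assms by (simp add: rvor_payoff_23)
qed

theorem theorem4:
  "\<exists>(V :: (nat \<times> nat) set) (E :: nat \<Rightarrow> (nat \<times> nat) set set).
     temporal_grid V E \<and> monotonically_growing E \<and>
     \<not> (\<exists>p1 p2. rvor_nash_equilibrium V E p1 p2)"
proof (intro exI conjI notI)
  show "temporal_grid V23 E23" by (rule temporal_grid_23)
  show "monotonically_growing E23" by (rule monotonically_growing_E23)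
  assume "\<exists>p1 p2. rvor_nash_equilibrium V23 E23 p1 p2"
  then obtain p q where eq: "rvor_nash_equilibrium V23 E23 p q" by blast
  then have "p \<in> V23" "q \<in> V23" by (auto simp: rvor_nash_equilibrium_def)
  then obtain p' where "p' \<in> V23"
    "rvor_payoff V23 E23 p q < rvor_payoff V23 E23 p' q \<or>
     rvor_payoff V23 E23 q p < rvor_payoff V23 E23 p' p"
    using profitable_deviation by blast
  with eq show False by (auto simp: rvor_nash_equilibrium_def not_le[symmetric])
qed

end
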